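(* Let $k$ and $n$ be positive integers with $n\neq 2$. Then \[(\log\Phi_n)^{(k)}(-1)=(-1)^{k-1}(k-1)!\,s_k(n\alpha_n)=(-1)^k\sum_{j=1}^k\frac{B_j^+\,s(k,j)}{j}J_j(n\alpha_n).\]
   Context: $\Phi_n$ is the $n$-th cyclotomic polynomial; $(\log f)^{(k)}$ means $(f'/f)^{(k-1)}$. For $m\ge2$, $s_k(m)=\sum_{1\le j\le m,\ \gcd(j,m)=1}(\zeta_m^j-1)^{-k}$ with $\zeta_m=e^{2\pi i/m}$. $\alpha_n=2$ if $n$ is odd, $\alpha_n=1/2$ if $2\mid n$, $4\nmid n$, and $\alpha_n=1$ if $4\mid n$. $s(k,j)$ are signed Stirling numbers of the first kind ($x(x-1)\cdots(x-k+1)=\sum_j s(k,j)x^j$), $B_j^+$ are given by $\frac{te^t}{e^t-1}=\sum_j B_j^+t^j/j!$, and $J_j(m)=m^j\prod_{p\mid m}(1-p^{-j})$. *)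

theory Defs
  imports "HOL-Complex_Analysis.Complex_Analysis" "HOL-Number_Theory.Totient"
begin

definition zeta :: "nat \<Rightarrow> complex" where
  "zeta m = exp (2 * of_real pi * \<i> / of_nat m)"

definition cyclotomic :: "nat \<Rightarrow> complex poly" where
  "cyclotomic n = (\<Prod>j\<in>totatives n. [:- (zeta n ^ j), 1:])"

text \<open>
  The \<open>k\<close>-th derivative of \<open>log f\<close>, for \<open>k \<ge> 1\<close>, read as the \<open>(k-1)\<close>-st derivative of
  the logarithmic derivative, so that no branch of the logarithm is involved.
\<close>
definition higher_logderiv :: "nat \<Rightarrow> (complex \<Rightarrow> complex) \<Rightarrow> complex \<Rightarrow> complex" where
  "higher_logderiv k f = (deriv ^^ (k - 1)) (\<lambda>z. deriv f z / f z)"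

definition s_sum :: "nat \<Rightarrow> nat \<Rightarrow> complex" where
  "s_sum k m = (\<Sum>j\<in>totatives m. 1 / (zeta m ^ j - 1) ^ k)"

definition alpha :: "nat \<Rightarrow> rat" where
  "alpha n = (if odd n then 2 else if 4 dvd n then 1 else 1 / 2)"

text \<open>
  The number \<open>n * alpha n\<close> as a natural number. The floor only changes the type;
  it does not round, as the lemma below shows.
\<close>
definition n_alpha :: "nat \<Rightarrow> nat" where
  "n_alpha n = nat \<lfloor>of_nat n * alpha n\<rfloor>"

lemma of_nat_n_alpha: "of_nat (n_alpha n) = of_nat n * alpha n"
proof -
  have "\<exists>m. of_nat n * alpha n = rat_of_nat m"
  proof (cases "odd n")
    case True
    then show ?thesis by (intro exI[of _ "2 * n"]) (simp add: alpha_def)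
  next
    case False
    then obtain l where "n = 2 * l" by auto
    with False show ?thesis
      by (intro exI[of _ "if 4 dvd n then n else l"]) (simp add: alpha_def)
  qed
  then show ?thesis by (auto simp: n_alpha_def)
qed

text \<open>
  Signed Stirling numbers of the first kind, as the coefficients of the falling factorial
  \<open>x (x - 1) \<dots> (x - k + 1)\<close>; the library's \<open>stirling\<close> is the unsigned version.
\<close>
definition signed_stirling :: "nat \<Rightarrow> nat \<Rightarrow> int" where
  "signed_stirling k j = coeff (\<Prod>i<k. [:- int i, 1:]) j"

text \<open>
  Bernoulli numbers with \<open>B\<^sub>1 = 1/2\<close>. The denominator \<open>e\<^sup>t - 1\<close> is not a unit in the ring of
  formal power series, but the division is exact.
\<close>
definition bernoulli_plus :: "nat \<Rightarrow> real" where
  "bernoulli_plus j = fact j * fps_nth (fps_X * fps_exp 1 / (fps_exp 1 - 1)) j"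

lemma bernoulli_plus_fps:
  "Abs_fps (\<lambda>j. bernoulli_plus j / fact j) * (fps_exp 1 - 1) = fps_X * fps_exp 1"
proof -
  let ?g = "fps_exp 1 - 1 :: real fps"
  have g1: "fps_nth ?g 1 = 1" by simp
  then have "?g \<noteq> 0" by (metis fps_zero_nth zero_neq_one)
  moreover have "subdegree ?g \<le> 1" using g1 by (intro subdegree_leI) simp
  moreover have "subdegree (fps_X * fps_exp 1 :: real fps) = 1" by simp
  ultimately have "?g dvd fps_X * fps_exp 1"
    by (subst fps_dvd_iff) auto
  then show ?thesis by (simp add: bernoulli_plus_def fps_nth_inverse)
qed

definition jordan_totient :: "nat \<Rightarrow> nat \<Rightarrow> real" where
  "jordan_totient j m = real m ^ j * (\<Prod>p\<in>prime_factors m. 1 - 1 / real p ^ j)"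

end

(*
The k-fold logarithmic derivative of Phi_n at -1 is a sum of (-1 - w)^(-k) over the primitive n-th
roots of unity w, and w |-> -w maps these onto the primitive roots of order n * alpha n; this gives
the first equality.

For the second, summing over the divisors d > 1 of m turns s_k(d) into a sum over all m-th roots of
unity z other than 1, and J_j(d) into m^j - 1, so it suffices to evaluate the former sum. With
E = e^t, the power series h = E / (E - z) satisfies h' = h - h^2, hence
(D - 1) ... (D - (k - 1)) h = (-1)^(k-1) (k-1)! h^k, whose constant term is a multiple of (z - 1)^(-k);
the coefficients of this differential operator are Stirling numbers. The sum of h over all z is
the logarithmic derivative of (E^m - 1) / (E - 1), which is a difference of two Bernoulli series.
*)
theory Submission
  imports Defs
begin

unbundle no vec_syntax

section \<open>Primitive roots of unity\<close>

text \<open>The order is encoded through all exponents at once, so that comparing orders becomes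
  comparing divisibility conditions.\<close>

definition primitive_roots :: "nat \<Rightarrow> complex set" where
  "primitive_roots d = {z. \<forall>k. z ^ k = 1 \<longleftrightarrow> d dvd k}"

lemma zeta_power: "zeta d ^ j = exp (2 * of_real pi * \<i> * of_nat j / of_nat d)"
  by (simp add: zeta_def exp_of_nat_mult [symmetric] mult_ac)

lemma zeta_power_eq_1_iff: "d > 0 \<Longrightarrow> zeta d ^ j = 1 \<longleftrightarrow> d dvd j"
  by (simp add: zeta_power complex_root_unity_eq_1)

text \<open>For \<open>j\<close> coprime to \<open>d\<close>, \<open>d\<close> divides
  \<open>j * k\<close> only if it divides \<open>k\<close>, so \<open>zeta d ^ j\<close> has order
  \<open>d\<close>. Conversely, every root of order \<open>d\<close> is a power of
  \<open>zeta d\<close>, and a common factor of \<open>j\<close> and \<open>d\<close> would lower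
  its order.\<close>

lemma bij_betw_totatives_primitive_roots:
  assumes "d > 0"
  shows "bij_betw (\<lambda>j. zeta d ^ j) (totatives d) (primitive_roots d)"
  unfolding bij_betw_def
proof
  show "inj_on (\<lambda>j. zeta d ^ j) (totatives d)"
  proof
    fix i j assume i: "i \<in> totatives d" and j: "j \<in> totatives d" and "zeta d ^ i = zeta d ^ j"
    then have m: "i mod d = j mod d" using assms by (simp add: zeta_power complex_root_unity_eq)
    show "i = j"
    \<comment> \<open>The only totative of 1 is 1 itself, which is not below the modulus, so
      residues can be compared directly only for larger \<open>d\<close>.\<close>
    proof (cases "d = 1")
      case True
      with i j show ?thesis by (simp add: totatives_def)
    next
      case False
      then show ?thesis using totatives_less[OF i] totatives_less[OF j] m assms by simp
    qed
  qed
  show "(\<lambda>j. zeta d ^ j) ` totatives d = primitive_roots d"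
  proof (intro equalityI subsetI)
    fix z assume "z \<in> (\<lambda>j. zeta d ^ j) ` totatives d"
    then obtain j where j: "j \<in> totatives d" "z = zeta d ^ j" by auto
    then have "coprime d j" by (simp add: totatives_def coprime_commute)
    then show "z \<in> primitive_roots d" using assms j
      by (simp add: primitive_roots_def zeta_power_eq_1_iff power_mult [symmetric]
          coprime_dvd_mult_right_iff)
  next
    fix z assume z: "z \<in> primitive_roots d"
    then have zd: "z ^ k = 1 \<longleftrightarrow> d dvd k" for k by (simp add: primitive_roots_def)
    then have "z \<in> {z. z ^ d = 1}" by simp
    then obtain i where i: "i < d" "z = zeta d ^ i"
      using complex_roots_unity[of d] assms by (auto simp: zeta_power)
    \<comment> \<open>Totatives lie between 1 and \<open>d\<close>, so the exponent 0 is replaced by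
      \<open>d\<close>, which gives the same power.\<close>
    define j where "j = (if i = 0 then d else i)"
    have j: "0 < j" "j \<le> d" "z = zeta d ^ j"
      using i assms by (auto simp: j_def zeta_power_eq_1_iff)
    \<comment> \<open>With the cofactors \<open>e\<close> and \<open>f\<close> of the gcd,
      \<open>j * e\<close> is a multiple of \<open>d\<close>, so \<open>z ^ e = 1\<close>. As
      \<open>z\<close> has order \<open>d\<close>, this forces \<open>d dvd e\<close>, hence gcd
      1.\<close>
    obtain e where e: "d = gcd j d * e" by (meson dvd_def gcd_dvd2)
    obtain f where f: "j = gcd j d * f" by (meson dvd_def gcd_dvd1)
    have "j * e = d * f" using e f by (metis mult.commute mult.left_commute)
    then have "z ^ e = 1" using assms j(3)
      by (simp add: power_mult [symmetric] zeta_power_eq_1_iff)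
    then have "d dvd e" using zd by simp
    moreover have "e > 0" using e assms by (metis mult_0_right not_gr_zero)
    ultimately have "d \<le> e" by (simp add: dvd_imp_le)
    then have "gcd j d = 1" using e \<open>e > 0\<close> assms
      by (metis One_nat_def Suc_leI dvd_triv_right gcd_pos_nat j(1) mult_eq_self_implies_10 nat_dvd_not_less le_eq_less_or_eq mult.commute)
    then show "z \<in> (\<lambda>j. zeta d ^ j) ` totatives d"
      using j by (auto simp: totatives_def coprime_iff_gcd_eq_1)
  qed
qed

lemma finite_primitive_roots: "d > 0 \<Longrightarrow> finite (primitive_roots d)"
  using bij_betw_finite[OF bij_betw_totatives_primitive_roots] by simp

lemma sum_primitive_roots:
  "d > 0 \<Longrightarrow> (\<Sum>j\<in>totatives d. f (zeta d ^ j)) = (\<Sum>z\<in>primitive_roots d. f z)"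
  by (rule sum.reindex_bij_betw[OF bij_betw_totatives_primitive_roots])

lemma prod_primitive_roots:
  "d > 0 \<Longrightarrow> (\<Prod>j\<in>totatives d. f (zeta d ^ j)) = (\<Prod>z\<in>primitive_roots d. f z)"
  by (rule prod.reindex_bij_betw[OF bij_betw_totatives_primitive_roots])

section \<open>Negation of primitive roots and the order \<open>n_alpha n\<close>\<close>

lemma n_alpha_odd: "odd n \<Longrightarrow> n_alpha n = 2 * n"
proof -
  assume "odd n"
  then have "rat_of_nat (n_alpha n) = of_nat (2 * n)"
    using of_nat_n_alpha[of n] by (simp add: alpha_def)
  then show ?thesis by (simp only: of_nat_eq_iff)
qed

lemma n_alpha_mod4: "4 dvd n \<Longrightarrow> n_alpha n = n"
  using of_nat_n_alpha[of n] by (auto simp add: alpha_def elim!: dvdE)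

lemma n_alpha_twice_odd: "odd l \<Longrightarrow> n_alpha (2 * l) = l"
proof -
  assume "odd l"
  then have "\<not> 4 dvd 2 * l" by presburger
  then show ?thesis using of_nat_n_alpha[of "2 * l"]
    by (simp add: alpha_def)
qed

lemma n_alpha_cases [case_names odd twice_odd mod4]:
  fixes n :: nat
  obtains "odd n" | l where "n = 2 * l" "odd l" | "4 dvd n"
proof -
  have "odd n \<or> (\<exists>l. n = 2 * l \<and> odd l) \<or> 4 dvd n" by presburger
  then show ?thesis using that by blast
qed

text \<open>Odd numbers are swapped with their doubles and multiples of 4 are fixed. Negation is
  therefore its own inverse between the two sets of primitive roots.\<close>

lemma n_alpha_involution: "n_alpha (n_alpha n) = n"
  by (cases n rule: n_alpha_cases) (simp_all add: n_alpha_odd n_alpha_mod4 n_alpha_twice_odd)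

text \<open>For even \<open>k\<close> the sign disappears from \<open>(- z) ^ k\<close>. For odd
  \<open>k\<close> the power is 1 iff \<open>z ^ k = -1\<close>, that is, iff \<open>z ^ k\<close>
  is a square root of 1 other than 1.\<close>

lemma uminus_primitive_root:
  assumes "z \<in> primitive_roots n"
  shows "- z \<in> primitive_roots (n_alpha n)"
proof -
  have z: "z ^ k = 1 \<longleftrightarrow> n dvd k" for k using assms by (simp add: primitive_roots_def)
  have minus: "z ^ k = -1 \<longleftrightarrow> n dvd 2 * k \<and> \<not> n dvd k" for k
  proof -
    have "(z ^ k)\<^sup>2 = 1 \<longleftrightarrow> n dvd 2 * k"
      unfolding z[symmetric] by (simp add: mult.commute flip: power_mult)
    moreover have "(-1 :: complex) \<noteq> 1" by simp
    ultimately show ?thesis using z[of k] power2_eq_1_iff[of "z ^ k"] by metis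
  qed
  have "(- z) ^ k = 1 \<longleftrightarrow> (if even k then n dvd k else n dvd 2 * k \<and> \<not> n dvd k)" for k
  proof (cases "even k")
    case True
    then show ?thesis using z[of k] by simp
  next
    case False
    then have "(- z) ^ k = 1 \<longleftrightarrow> z ^ k = -1" by (metis power_minus_odd minus_minus)
    then show ?thesis using minus[of k] False by simp
  qed
  \<comment> \<open>For odd \<open>n\<close>, \<open>n dvd 2 * k\<close> gives
    \<open>n dvd k\<close>, so only even \<open>k\<close> qualify. For \<open>n = 2 * l\<close> with
    \<open>l\<close> odd, both branches reduce to \<open>l dvd k\<close>. For
    \<open>4 dvd n\<close>, \<open>n dvd 2 * k\<close> already makes \<open>k\<close> even.\<close>
  moreover have "(if even k then n dvd k else n dvd 2 * k \<and> \<not> n dvd k) \<longleftrightarrow> n_alpha n dvd k" for k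
  proof (cases n rule: n_alpha_cases)
    case odd
    then have "coprime n 2" by simp
    with odd show ?thesis
      by (auto simp: n_alpha_odd coprime_dvd_mult_right_iff intro: divides_mult[of 2 n k, simplified])
  next
    case (twice_odd l)
    then show ?thesis
      by (auto simp: n_alpha_twice_odd intro: divides_mult[of 2 l k, simplified])
  next
    case mod4
    then obtain l where "n = 4 * l" by auto
    then show ?thesis using mod4 by (auto simp: n_alpha_mod4)
  qed
  ultimately show ?thesis by (simp add: primitive_roots_def)
qed

lemma bij_betw_uminus_primitive_roots:
  "bij_betw uminus (primitive_roots n) (primitive_roots (n_alpha n))"
  by (rule bij_betw_byWitness[where f' = uminus])
    (use uminus_primitive_root uminus_primitive_root[of _ "n_alpha n"] in
      \<open>auto simp: n_alpha_involution\<close>)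

text \<open>Among positive \<open>n\<close> only 2 is sent to 1, where the sum \<open>s_sum\<close>
  would contain a vanishing denominator.\<close>

lemma n_alpha_gt_1:
  assumes "n > 0" "n \<noteq> 2"
  shows "n_alpha n > 1"
  using assms
  by (cases n rule: n_alpha_cases) (auto simp: n_alpha_odd n_alpha_mod4 n_alpha_twice_odd elim!: oddE)

section \<open>Sums over divisors\<close>

text \<open>Each root of unity is sorted by its order, the least positive exponent giving 1.
  Division with remainder shows that this exponent divides all others giving 1.\<close>

lemma roots_unity_eq_Union_primitive_roots:
  assumes "m > 0"
  shows "{z. z ^ m = 1} = (\<Union>d\<in>{d. d dvd m}. primitive_roots d)"
proof (intro equalityI subsetI)
  fix z :: complex assume "z \<in> {z. z ^ m = 1}"
  then have zm: "z ^ m = 1" by simp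
  define d where "d = (LEAST d. d > 0 \<and> z ^ d = 1)"
  have "d > 0 \<and> z ^ d = 1" unfolding d_def by (rule LeastI[of _ m]) (use assms zm in simp)
  then have d: "d > 0" "z ^ d = 1" by auto
  have "z ^ k = 1 \<longleftrightarrow> d dvd k" for k
  proof
    assume "z ^ k = 1"
    moreover have "z ^ k = (z ^ d) ^ (k div d) * z ^ (k mod d)"
      by (simp flip: power_mult power_add)
    ultimately have "z ^ (k mod d) = 1" using d by simp
    moreover have "k mod d < d" using d by simp
    ultimately show "d dvd k" unfolding d_def
      using not_less_Least[of "k mod d" "\<lambda>d. d > 0 \<and> z ^ d = 1"] by (auto simp flip: d_def)
  qed (use d in \<open>auto simp: power_mult elim!: dvdE\<close>)
  then show "z \<in> (\<Union>d\<in>{d. d dvd m}. primitive_roots d)"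
    using zm by (auto simp: primitive_roots_def)
qed (auto simp: primitive_roots_def)

lemma primitive_roots_disjoint: "d \<noteq> e \<Longrightarrow> primitive_roots d \<inter> primitive_roots e = {}"
  by (auto simp: primitive_roots_def) (metis dvd_refl dvd_antisym)

lemma primitive_roots_1: "primitive_roots (Suc 0) = {1}"
  by (auto simp: primitive_roots_def) (metis power_one_right)

text \<open>Only \<open>z = 1\<close> has order 1, so removing this root amounts to removing the
  divisor 1.\<close>

lemma sum_roots_unity_eq_sum_primitive_roots:
  fixes f :: "complex \<Rightarrow> complex"
  assumes "m > 0"
  shows "(\<Sum>z\<in>{z. z ^ m = 1} - {1}. f z) = (\<Sum>d\<in>{d. d dvd m} - {1}. \<Sum>z\<in>primitive_roots d. f z)"
proof -
  have "{z::complex. z ^ m = 1} - {1} = (\<Union>d\<in>{d. d dvd m} - {1}. primitive_roots d)"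
    using primitive_roots_disjoint[of _ "Suc 0"] assms
    by (auto simp: roots_unity_eq_Union_primitive_roots primitive_roots_1)
  moreover have "finite ({d. d dvd m} - {1})" using assms by simp
  moreover have "\<forall>d\<in>{d. d dvd m} - {1}. finite (primitive_roots d)"
    using assms by (auto intro!: finite_primitive_roots dvd_pos_nat)
  ultimately show ?thesis
    by (simp add: sum.UNION_disjoint primitive_roots_disjoint)
qed

text \<open>Strong induction, splitting off the full power \<open>p ^ a\<close> of a prime, with
  \<open>a = Suc b\<close> and \<open>m = p ^ a * n\<close>. The induction hypothesis at
  \<open>p ^ b * n\<close> and at \<open>n\<close> gives
  \<open>(p ^ b * n) ^ j + (p ^ (a * j) - p ^ (b * j)) * n ^ j\<close>, which telescopes to
  \<open>m ^ j\<close>.\<close>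

lemma sum_jordan_totient:
  assumes "m > 0"
  shows "(\<Sum>d\<in>{d. d dvd m}. jordan_totient j d) = real m ^ j"
  using assms
proof (induction m rule: less_induct)
  case (less m)
  show ?case
  proof (cases "m = 1")
    case True
    then show ?thesis by (simp add: jordan_totient_def)
  next
    case False
    then obtain p where p: "prime p" "p dvd m" using prime_factor_nat by blast
    obtain a n where n: "m = p ^ a * n" "\<not> p dvd n"
      using less.prems p(1) by (metis multiplicity_decompose' not_gr_zero not_prime_unit)
    then have "a \<noteq> 0" using p by (metis mult_1 power_0)
    then obtain b where b: "a = Suc b" using not0_implies_Suc by blast
    have "n > 0" using n less.prems by (auto intro: Nat.gr0I)
    have p1: "p > 1" using p by (rule_tac prime_gt_1_nat)
    define m' where "m' = p ^ b * n"
    have m: "m = p * m'" by (simp add: n b m'_def)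
    have m': "0 < m'" "m' < m" using less.prems p1 by (auto simp: m)
    have "n < m" using m' n(1) unfolding m'_def by (metis dvd_imp_le dvd_triv_right le_less_trans)
    \<comment> \<open>The exponent of \<open>p\<close> in a divisor is either at most
      \<open>b\<close> or exactly \<open>a\<close>.\<close>
    have split: "{d. d dvd m} = {d. d dvd m'} \<union> (\<lambda>e. p ^ a * e) ` {e. e dvd n}"
    proof (intro equalityI subsetI)
      fix d assume "d \<in> {d. d dvd m}"
      then have dm: "d dvd p ^ a * n" by (simp add: n)
      then obtain x y where xy: "d = x * y" "x dvd p ^ a" "y dvd n"
        using division_decomp by blast
      obtain i where i: "i \<le> a" "x = p ^ i" using xy p by (metis divides_primepow_nat)
      show "d \<in> {d. d dvd m'} \<union> (\<lambda>e. p ^ a * e) ` {e. e dvd n}"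
      proof (cases "i = a")
        case True
        then show ?thesis using xy i by auto
      next
        case False
        then have "x dvd p ^ b" using i b by (simp add: le_imp_power_dvd)
        then show ?thesis using xy by (auto simp: m'_def mult_dvd_mono)
      qed
    qed (auto simp: m n(1) m'_def b)
    have disj: "{d. d dvd m'} \<inter> (\<lambda>e. p ^ a * e) ` {e. e dvd n} = {}"
    proof -
      have "\<not> p ^ a * e dvd m'" for e
      proof
        assume "p ^ a * e dvd m'"
        then have "p ^ b * p dvd p ^ b * n" unfolding m'_def b
          by (metis dvd_mult_left power_Suc2)
        then show False using n(2) p1 by simp
      qed
      then show ?thesis by auto
    qed
    \<comment> \<open>As \<open>p\<close> does not divide \<open>e\<close>, the product over primes
      gains just the factor \<open>1 - 1 / p ^ j\<close>, and multiplying it by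
      \<open>p ^ (a * j)\<close> gives the difference.\<close>
    have mult: "jordan_totient j (p ^ a * e) = (real p ^ (a * j) - real p ^ (b * j)) * jordan_totient j e"
      if "e dvd n" for e
    proof -
      have e: "e > 0" "\<not> p dvd e" using that n(2) \<open>n > 0\<close> dvd_pos_nat dvd_trans by blast+
      have "prime_factors (p ^ a) = {p}"
        using p \<open>a \<noteq> 0\<close> prime_factors_power[of a p] by (simp add: prime_prime_factors)
      then have "prime_factors (p ^ a * e) = insert p (prime_factors e)"
        using e p1 by (subst prime_factors_product) auto
      moreover have "p \<notin> prime_factors e" using e by auto
      ultimately show ?thesis using p1
        by (simp add: jordan_totient_def power_mult_distrib b field_simps power_mult power_add)
    qed
    have "(\<Sum>d\<in>{d. d dvd m}. jordan_totient j d)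
        = (\<Sum>d\<in>{d. d dvd m'}. jordan_totient j d)
          + (\<Sum>d\<in>(\<lambda>e. p ^ a * e) ` {e. e dvd n}. jordan_totient j d)"
      unfolding split using disj m' \<open>n > 0\<close> by (intro sum.union_disjoint) auto
    also have "(\<Sum>d\<in>(\<lambda>e. p ^ a * e) ` {e. e dvd n}. jordan_totient j d)
        = (\<Sum>e\<in>{e. e dvd n}. jordan_totient j (p ^ a * e))"
      using p1 by (subst sum.reindex) (auto simp: inj_on_def)
    also have "\<dots> = (real p ^ (a * j) - real p ^ (b * j)) * (\<Sum>e\<in>{e. e dvd n}. jordan_totient j e)"
      using mult by (simp add: sum_distrib_left)
    also have "(\<Sum>e\<in>{e. e dvd n}. jordan_totient j e) = real n ^ j"
      using less.IH \<open>n < m\<close> \<open>n > 0\<close> by blast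
    also have "(\<Sum>d\<in>{d. d dvd m'}. jordan_totient j d) = real m' ^ j"
      using less.IH m' by blast
    finally show ?thesis
      by (simp add: n(1) m'_def power_mult_distrib power_mult algebra_simps)
  qed
qed

text \<open>This takes the place of Moebius inversion: by strong induction all terms except
  \<open>d = m\<close> cancel. The divisor 1 is left out since \<open>s_sum\<close> is meaningful
  only from 2 on.\<close>

lemma eq_by_proper_divisor_sums:
  fixes f g :: "nat \<Rightarrow> 'a :: ab_group_add"
  assumes "\<And>m. m > 1 \<Longrightarrow> (\<Sum>d\<in>{d. d dvd m} - {1}. f d) = (\<Sum>d\<in>{d. d dvd m} - {1}. g d)"
  shows "m > 1 \<Longrightarrow> f m = g m"
proof (induction m rule: less_induct)
  case (less m)
  have fin: "finite ({d. d dvd m} - {1})" and m: "m \<in> {d. d dvd m} - {1}"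
    using less.prems by auto
  have "(\<Sum>d\<in>{d. d dvd m} - {1} - {m}. f d) = (\<Sum>d\<in>{d. d dvd m} - {1} - {m}. g d)"
  proof (rule sum.cong)
    fix d assume "d \<in> {d. d dvd m} - {1} - {m}"
    then have "d dvd m" "d \<noteq> 1" "d \<noteq> m" by auto
    moreover have "d > 0" "d \<le> m" using less.prems dvd_pos_nat[of m d] dvd_imp_le[of d m] \<open>d dvd m\<close> by auto
    ultimately show "f d = g d" by (intro less.IH) auto
  qed simp
  then show ?case using assms[OF less.prems]
    unfolding sum.remove[OF fin m] by simp
qed

section \<open>Products of linear factors and of power series\<close>

text \<open>Both polynomials have degree at most \<open>m\<close>, the same coefficient at
  \<open>m\<close>, and agree at \<open>m\<close> points. Stating it over any integral domain allows
  the roots to be constant power series.\<close>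

lemma prod_linear_roots_unity:
  fixes S :: "'a :: idom set"
  assumes "m > 0" "card S = m" "\<And>z. z \<in> S \<Longrightarrow> z ^ m = 1"
  shows "(\<Prod>z\<in>S. [:- z, 1:]) = monom 1 m - 1"
proof (rule poly_eqI_degree_lead_coeff[where A = S and n = m])
  have fin: "finite S" using assms card_gt_0_iff by metis
  have deg: "degree (\<Prod>z\<in>S. [:- z, 1:]) = m"
    using assms(2) by (subst degree_prod_eq_sum_degree) auto
  then show "degree (\<Prod>z\<in>S. [:- z, 1:]) \<le> m" by simp
  show "degree (monom 1 m - 1 :: 'a poly) \<le> m"
    by (intro degree_diff_le degree_monom_le) simp
  show "coeff (\<Prod>z\<in>S. [:- z, 1:]) m = coeff (monom 1 m - 1) m"
    using assms(1) deg lead_coeff_prod[of "\<lambda>z. [:- z, 1:]" S] by simp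
  show "m \<le> card S" using assms by simp
  fix z assume "z \<in> S"
  then show "poly (\<Prod>z\<in>S. [:- z, 1:]) z = poly (monom 1 m - 1) z"
    using assms fin by (auto simp: poly_prod poly_monom prod_zero_iff)
qed

text \<open>The logarithmic derivative of a product; nonzero constant terms make the factors
  invertible as power series.\<close>

lemma fps_deriv_prod_unit:
  fixes f :: "'b \<Rightarrow> 'a :: field fps"
  assumes "finite A" "\<And>x. x \<in> A \<Longrightarrow> f x $ 0 \<noteq> 0"
  shows "fps_deriv (\<Prod>x\<in>A. f x) = (\<Prod>x\<in>A. f x) * (\<Sum>x\<in>A. fps_deriv (f x) * inverse (f x))"
  using assms
proof (induction A rule: finite_induct)
  case (insert x A)
  then have "f x * inverse (f x) = 1" by (intro inverse_mult_eq_1') auto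
  then have fx: "f x * (fps_deriv (f x) * inverse (f x)) = fps_deriv (f x)"
    by (metis mult.left_commute mult.right_neutral)
  let ?S = "\<lambda>A. \<Sum>x\<in>A. fps_deriv (f x) * inverse (f x)"
  have IH: "fps_deriv (\<Prod>x\<in>A. f x) = (\<Prod>x\<in>A. f x) * ?S A"
    using insert by simp
  have "fps_deriv (\<Prod>x\<in>insert x A. f x)
      = f x * ((\<Prod>x\<in>A. f x) * ?S A) + (f x * (fps_deriv (f x) * inverse (f x))) * (\<Prod>x\<in>A. f x)"
    unfolding fx using insert.hyps IH by simp
  also have "\<dots> = f x * (\<Prod>x\<in>A. f x) * (fps_deriv (f x) * inverse (f x) + ?S A)"
    by (simp only: distrib_left mult_ac add_ac)
  finally show ?case using insert.hyps by simp
qed simp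

lemma funpow_fps_deriv_nth_0:
  fixes f :: "'a :: {comm_semiring_1, semiring_char_0} fps"
  shows "(fps_deriv ^^ n) f $ 0 = fact n * f $ n"
proof (induction n arbitrary: f)
  case (Suc n)
  then show ?case by (simp add: funpow_Suc_right algebra_simps del: funpow.simps)
qed simp

section \<open>Stirling numbers as coefficients of a differential operator\<close>

text \<open>This is \<open>(x - 1) ... (x - n)\<close>, the falling factorial of length
  \<open>Suc n\<close> without its factor \<open>x\<close>; hence both Stirling indices shift by
  one.\<close>

definition shifted_stirling_poly :: "nat \<Rightarrow> int poly" where
  "shifted_stirling_poly n = (\<Prod>i<n. [:- int (Suc i), 1:])"

lemma signed_stirling_Suc_Suc:
  "signed_stirling (Suc n) (Suc j) = coeff (shifted_stirling_poly n) j"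
  unfolding signed_stirling_def shifted_stirling_poly_def
  by (subst prod.lessThan_Suc_shift) simp

lemma degree_shifted_stirling_poly: "degree (shifted_stirling_poly n) = n"
  unfolding shifted_stirling_poly_def
  by (subst degree_prod_eq_sum_degree) auto

lemma shifted_stirling_poly_Suc:
  "shifted_stirling_poly (Suc n) = [:- int (Suc n), 1:] * shifted_stirling_poly n"
  by (simp add: shifted_stirling_poly_def mult.commute)

text \<open>The left side is \<open>(D - 1) ... (D - n)\<close> applied to \<open>h\<close>. The
  next factor \<open>D - (n + 1)\<close> sends \<open>h ^ (n + 1)\<close> to
  \<open>(n + 1) * h ^ n * (h - h ^ 2) - (n + 1) * h ^ (n + 1)\<close>, which is
  \<open>- (n + 1) * h ^ (n + 2)\<close>.\<close>

lemma shifted_stirling_deriv: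
  fixes h :: "'a :: field_char_0 fps"
  assumes h: "fps_deriv h = h - h ^ 2"
  shows "(\<Sum>j\<le>n. of_int (coeff (shifted_stirling_poly n) j) * (fps_deriv ^^ j) h)
       = (-1) ^ n * fact n * h ^ Suc n"
proof (induction n)
  case 0
  then show ?case by (simp add: shifted_stirling_poly_def)
next
  case (Suc n)
  let ?q = "shifted_stirling_poly n" and ?D = "\<lambda>j. (fps_deriv ^^ j) h"
  \<comment> \<open>The factor \<open>x\<close> shifts the coefficients, which corresponds to one
    more derivative of the whole sum.\<close>
  have c: "coeff (shifted_stirling_poly (Suc n)) j
      = coeff (pCons 0 ?q) j - int (Suc n) * coeff ?q j" for j
    unfolding shifted_stirling_poly_Suc by (simp add: algebra_simps)
  have top: "coeff ?q (Suc n) = 0"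
    by (rule coeff_eq_0) (simp add: degree_shifted_stirling_poly)
  have "(\<Sum>j\<le>Suc n. of_int (coeff (shifted_stirling_poly (Suc n)) j) * ?D j)
      = (\<Sum>j\<le>Suc n. of_int (coeff (pCons 0 ?q) j) * ?D j)
        - of_nat (Suc n) * (\<Sum>j\<le>Suc n. of_int (coeff ?q j) * ?D j)"
    unfolding c by (simp only: sum_distrib_left sum_subtractf[symmetric]) (simp add: algebra_simps)
  also have "(\<Sum>j\<le>Suc n. of_int (coeff ?q j) * ?D j) = (\<Sum>j\<le>n. of_int (coeff ?q j) * ?D j)"
    by (simp add: top)
  also have "(\<Sum>j\<le>Suc n. of_int (coeff (pCons 0 ?q) j) * ?D j)
      = fps_deriv (\<Sum>j\<le>n. of_int (coeff ?q j) * ?D j)"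
    by (subst sum.atMost_Suc_shift) (simp add: fps_deriv_sum)
  also have "(\<Sum>j\<le>n. of_int (coeff ?q j) * ?D j) = (-1) ^ n * fact n * h ^ Suc n"
    by (rule Suc.IH)
  also have "fps_deriv ((-1) ^ n * fact n * h ^ Suc n)
      - of_nat (Suc n) * ((-1) ^ n * fact n * h ^ Suc n) = (-1) ^ Suc n * fact (Suc n) * h ^ Suc (Suc n)"
  proof -
    \<comment> \<open>Written as an embedded integer, the factor is visibly a constant for
      \<open>fps_deriv\<close>.\<close>
    have "(-1) ^ n * fact n = (of_int ((-1) ^ n * fact n) :: 'a fps)" by simp
    then have "fps_deriv ((-1) ^ n * fact n * h ^ Suc n)
        = (-1) ^ n * fact n * (of_nat (Suc n) * (h - h ^ 2) * h ^ n)"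
      by (simp only: fps_deriv_mult fps_deriv_of_int fps_deriv_power' h) simp
    then show ?thesis by (simp add: algebra_simps power2_eq_square)
  qed
  finally show ?case .
qed

section \<open>Bernoulli series and sums over all roots of unity\<close>

definition bernoulli_fps :: "complex fps" where
  "bernoulli_fps = Abs_fps (\<lambda>j. of_real (bernoulli_plus j) / fact j)"

lemma bernoulli_fps_mult: "bernoulli_fps * (fps_exp 1 - 1) = fps_X * fps_exp 1"
proof (rule fps_ext)
  fix n
  have "complex_of_real ((Abs_fps (\<lambda>j. bernoulli_plus j / fact j) * (fps_exp 1 - 1)) $ n)
      = of_real ((fps_X * fps_exp 1) $ n)"
    by (simp only: bernoulli_plus_fps)
  then show "(bernoulli_fps * (fps_exp 1 - 1)) $ n = (fps_X * fps_exp 1) $ n"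
    by (simp add: fps_mult_nth bernoulli_fps_def if_distrib[of complex_of_real] cong: if_cong)
qed

text \<open>For \<open>z \<noteq> 1\<close> this is the series \<open>h = E / (E - z)\<close> with
  \<open>E\<close> the exponential series; the denominator has constant term
  \<open>1 - z\<close>.\<close>

definition unit_quotient :: "complex \<Rightarrow> complex fps" where
  "unit_quotient z = fps_exp 1 * inverse (fps_exp 1 - fps_const z)"

lemma unit_quotient_nth_0: "unit_quotient z $ 0 = 1 / (1 - z)"
  by (simp add: unit_quotient_def divide_inverse)

lemma fps_deriv_unit_quotient:
  assumes "z \<noteq> 1"
  shows "fps_deriv (unit_quotient z) = unit_quotient z - unit_quotient z ^ 2"
proof -
  let ?g = "fps_exp 1 - fps_const z :: complex fps"
  have "?g $ 0 \<noteq> 0" using assms by simp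
  then have "fps_deriv (inverse ?g) = - fps_deriv ?g * inverse ?g ^ 2"
    by (rule fps_inverse_deriv)
  then show ?thesis
    unfolding unit_quotient_def by (simp add: algebra_simps power2_eq_square)
qed

text \<open>The sum is the logarithmic derivative of \<open>(E ^ m - 1) / (E - 1)\<close>, namely
  \<open>m * E ^ m / (E ^ m - 1) - E / (E - 1)\<close>. Multiplied by the variable, the two terms
  are the Bernoulli series at \<open>m * t\<close> and at \<open>t\<close>.\<close>

lemma sum_unit_quotient:
  assumes "m > 0"
  defines "R \<equiv> {z. z ^ m = 1} - {1}"
  shows "fps_X * (\<Sum>z\<in>R. unit_quotient z)
       = (bernoulli_fps oo (fps_const (of_nat m) * fps_X)) - bernoulli_fps"
proof -
  let ?E = "fps_exp 1 :: complex fps" and ?U = "{z::complex. z ^ m = 1}"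
  define P where "P = (\<Prod>z\<in>R. ?E - fps_const z)"
  define H where "H = (\<Sum>z\<in>R. unit_quotient z)"
  define B where "B = bernoulli_fps oo (fps_const (of_nat m) * fps_X)"
  have card: "card ?U = m" using card_complex_roots_unity assms by simp
  then have fin: "finite ?U" using assms by (metis card.infinite less_irrefl)
  have Em: "?E ^ m = fps_exp (of_nat m)" by (simp add: fps_exp_power_mult)
  \<comment> \<open>The roots are embedded as constant series, so that the factorisation can be
    evaluated at the series \<open>E\<close>.\<close>
  have "poly (\<Prod>z\<in>fps_const ` ?U. [:- z, 1:]) ?E = poly (monom 1 m - 1) ?E"
    using assms card
    by (subst prod_linear_roots_unity[of m]) (auto simp: card_image inj_on_def)
  then have "(\<Prod>z\<in>?U. ?E - fps_const z) = ?E ^ m - 1"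
    by (simp add: poly_prod poly_monom prod.reindex inj_on_def del: fps_const_neg)
  moreover have "(\<Prod>z\<in>?U. ?E - fps_const z) = (?E - 1) * P"
    unfolding P_def R_def using fin by (subst prod.remove[of _ 1]) auto
  ultimately have P: "P * (?E - 1) = ?E ^ m - 1" by (simp add: mult.commute)
  have dP: "fps_deriv P = P * H"
    unfolding P_def H_def unit_quotient_def using fin
    by (subst fps_deriv_prod_unit) (auto simp: R_def)
  have "fps_deriv (P * (?E - 1)) = fps_deriv (?E ^ m - 1)" by (simp only: P)
  then have D: "P * H * (?E - 1) + P * ?E = of_nat m * ?E ^ m"
    by (simp add: dP Em fps_of_nat add.commute)
  have "(bernoulli_fps * (fps_exp 1 - 1)) oo (fps_const (of_nat m) * fps_X)
      = (fps_X * fps_exp 1) oo (fps_const (of_nat m) * fps_X)"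
    by (simp only: bernoulli_fps_mult)
  then have B: "B * (?E ^ m - 1) = of_nat m * fps_X * ?E ^ m"
    by (simp add: fps_compose_mult_distrib fps_compose_sub_distrib B_def Em flip: fps_of_nat)
  \<comment> \<open>The series \<open>E ^ m - 1\<close> has constant term 0 and is not invertible,
    so both sides are multiplied by it and it is cancelled at the end as a nonzero factor.\<close>
  have "fps_X * H * (?E ^ m - 1) = fps_X * (P * H * (?E - 1))"
    by (simp flip: P add: mult_ac)
  also have "\<dots> = of_nat m * fps_X * ?E ^ m - P * (fps_X * ?E)"
    using D by (simp add: algebra_simps flip: D)
  also have "\<dots> = (B - bernoulli_fps) * (?E ^ m - 1)"
    by (simp only: B[symmetric] bernoulli_fps_mult[symmetric] P[symmetric]) (simp add: algebra_simps)
  finally have "fps_X * H * (?E ^ m - 1) = (B - bernoulli_fps) * (?E ^ m - 1)" .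
  moreover have "?E ^ m - 1 \<noteq> 0" using assms by (simp add: Em)
  ultimately show ?thesis unfolding B_def H_def by simp
qed

text \<open>Constant terms are compared in \<open>shifted_stirling_deriv\<close>, summed over all
  \<open>h\<close>. There the \<open>j\<close>-th derivative contributes \<open>fact j\<close> times
  the \<open>j\<close>-th coefficient, which the Bernoulli series supply.\<close>

lemma sum_roots_unity_inverse_power:
  assumes "m > 0"
  shows "fact n * (\<Sum>z\<in>{z::complex. z ^ m = 1} - {1}. 1 / (z - 1) ^ Suc n)
       = - (\<Sum>j=1..Suc n. of_real (bernoulli_plus j) * of_int (signed_stirling (Suc n) j)
              / of_nat j * (of_nat m ^ j - 1))"
proof -
  define R where "R = {z::complex. z ^ m = 1} - {1}"
  define H where "H = (\<Sum>z\<in>R. unit_quotient z)"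
  \<comment> \<open>The factor \<open>fps_X\<close> shifts the index by one, and
    \<open>fact (Suc j) = Suc j * fact j\<close> leaves the denominator
    \<open>Suc j\<close>.\<close>
  have H: "fact j * H $ j = of_real (bernoulli_plus (Suc j)) / of_nat (Suc j) * (of_nat m ^ Suc j - 1)" for j
  proof -
    have "(fps_X * H) $ Suc j
        = ((bernoulli_fps oo (fps_const (of_nat m) * fps_X)) - bernoulli_fps) $ Suc j"
      using assms by (simp only: H_def R_def sum_unit_quotient)
    then have "H $ j = of_nat m ^ Suc j * (of_real (bernoulli_plus (Suc j)) / fact (Suc j))
        - of_real (bernoulli_plus (Suc j)) / fact (Suc j)"
      by (simp add: bernoulli_fps_def del: power_Suc fact_Suc)
    moreover have "(fact (Suc j) :: complex) = of_nat (Suc j) * fact j" by simp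
    ultimately show ?thesis by (simp add: field_simps del: of_nat_Suc power_Suc fact_Suc)
  qed
  have summand: "(\<Sum>j\<le>n. of_int (coeff (shifted_stirling_poly n) j) * (fact j * unit_quotient z $ j))
      = - fact n * (1 / (z - 1) ^ Suc n)" if "z \<in> R" for z
  proof -
    have z: "z \<noteq> 1" using that by (simp add: R_def)
    \<comment> \<open>Passing from \<open>1 - z\<close> to \<open>z - 1\<close> costs
      \<open>Suc n\<close> signs against the \<open>n\<close> signs of the operator identity, whence
      the overall minus.\<close>
    have "(1 - z) ^ Suc n = (-1) ^ Suc n * (z - 1) ^ Suc n"
      by (metis minus_diff_eq mult_minus1 power_mult_distrib)
    then have sign: "(-1) ^ n * (1 / (1 - z)) ^ Suc n = - (1 / (z - 1) ^ Suc n)"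
      using z by (simp add: power_one_over field_simps)
    have "(fact n :: complex fps) = fps_const (fact n)" by (metis fps_of_nat of_nat_fact)
    then have nth_0: "((-1) ^ n * fact n * unit_quotient z ^ Suc n) $ 0
        = fact n * ((-1) ^ n * (1 / (1 - z)) ^ Suc n)"
      by (simp add: fps_nth_power_0 unit_quotient_nth_0)
    have "(\<Sum>j\<le>n. of_int (coeff (shifted_stirling_poly n) j) * (fact j * unit_quotient z $ j))
        = (\<Sum>j\<le>n. of_int (coeff (shifted_stirling_poly n) j) * (fps_deriv ^^ j) (unit_quotient z)) $ 0"
      by (simp add: fps_sum_nth funpow_fps_deriv_nth_0)
    also have "\<dots> = fact n * - (1 / (z - 1) ^ Suc n)"
      by (simp only: shifted_stirling_deriv[OF fps_deriv_unit_quotient[OF z]] nth_0 sign)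
    finally show ?thesis by simp
  qed
  have "- (fact n * (\<Sum>z\<in>R. 1 / (z - 1) ^ Suc n))
      = (\<Sum>z\<in>R. \<Sum>j\<le>n. of_int (coeff (shifted_stirling_poly n) j) * (fact j * unit_quotient z $ j))"
    using summand by (simp add: sum_distrib_left sum_negf)
  also have "\<dots> = (\<Sum>j\<le>n. of_int (coeff (shifted_stirling_poly n) j) * (fact j * H $ j))"
    by (subst sum.swap) (simp add: H_def fps_sum_nth sum_distrib_left)
  also have "\<dots> = (\<Sum>j\<le>n. of_real (bernoulli_plus (Suc j)) * of_int (signed_stirling (Suc n) (Suc j))
              / of_nat (Suc j) * (of_nat m ^ Suc j - 1))"
    by (simp only: H signed_stirling_Suc_Suc) (simp add: mult_ac)
  also have "\<dots> = (\<Sum>j=1..Suc n. of_real (bernoulli_plus j) * of_int (signed_stirling (Suc n) j)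
              / of_nat j * (of_nat m ^ j - 1))"
    unfolding One_nat_def by (subst sum.atLeast_Suc_atMost_Suc_shift) (simp add: atLeast0AtMost)
  finally show ?thesis
    unfolding R_def by (subst (asm) minus_equation_iff) (rule sym)
qed

section \<open>Evaluation of \<open>s_sum\<close> by Jordan totients\<close>

text \<open>Both sides have the same sums over the divisors \<open>d > 1\<close>: on the left the
  primitive roots combine to all roots other than 1, on the right the totients add up to
  \<open>m ^ j - 1\<close>.\<close>

lemma s_sum_eq:
  assumes "m > 1"
  shows "fact n * s_sum (Suc n) m
       = - (\<Sum>j=1..Suc n. of_real (bernoulli_plus j) * of_int (signed_stirling (Suc n) j)
              / of_nat j * of_real (jordan_totient j m))"
proof -
  define c where "c j = of_real (bernoulli_plus j) * of_int (signed_stirling (Suc n) j) / (of_nat j :: complex)" for j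
  have "fact n * s_sum (Suc n) m = (\<lambda>m. - (\<Sum>j=1..Suc n. c j * of_real (jordan_totient j m))) m"
  proof (rule eq_by_proper_divisor_sums[OF _ assms, of "\<lambda>m. fact n * s_sum (Suc n) m"])
    fix m :: nat assume m: "m > 1"
    let ?D = "{d. d dvd m} - {1}"
    have jordan: "(\<Sum>d\<in>?D. complex_of_real (jordan_totient j d)) = of_nat m ^ j - 1" for j
    proof -
      have "(\<Sum>d\<in>{d. d dvd m}. jordan_totient j d) = jordan_totient j 1 + (\<Sum>d\<in>?D. jordan_totient j d)"
        using m by (intro sum.remove) auto
      then have "(\<Sum>d\<in>?D. jordan_totient j d) = real m ^ j - 1"
        using sum_jordan_totient[of m j] m by (simp add: jordan_totient_def)
      then have "complex_of_real (\<Sum>d\<in>?D. jordan_totient j d) = of_real (real m ^ j - 1)"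
        by (simp only:)
      then show ?thesis by simp
    qed
    have "(\<Sum>d\<in>?D. fact n * s_sum (Suc n) d)
        = fact n * (\<Sum>d\<in>?D. \<Sum>z\<in>primitive_roots d. 1 / (z - 1) ^ Suc n)"
      unfolding sum_distrib_left[symmetric] s_sum_def
      using m by (intro arg_cong2[where f = "(*)"] sum.cong refl sum_primitive_roots)
        (auto intro: dvd_pos_nat[of m])
    also have "\<dots> = fact n * (\<Sum>z\<in>{z. z ^ m = 1} - {1}. 1 / (z - 1) ^ Suc n)"
      using m by (subst sum_roots_unity_eq_sum_primitive_roots) auto
    also have "\<dots> = - (\<Sum>j=1..Suc n. c j * (of_nat m ^ j - 1))"
      unfolding c_def using m by (intro sum_roots_unity_inverse_power) simp
    also have "\<dots> = (\<Sum>d\<in>?D. - (\<Sum>j=1..Suc n. c j * of_real (jordan_totient j d)))"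
      unfolding jordan[symmetric] sum_negf sum_distrib_left by (subst sum.swap) simp
    finally show "(\<Sum>d\<in>?D. fact n * s_sum (Suc n) d)
        = (\<Sum>d\<in>?D. - (\<Sum>j=1..Suc n. c j * of_real (jordan_totient j d)))" .
  qed
  then show ?thesis by (simp add: c_def)
qed

section \<open>Logarithmic derivatives of the cyclotomic polynomial\<close>

text \<open>The complement of the finite set \<open>R\<close> is open, so a formula valid there can
  be differentiated term by term, whatever values \<open>F\<close> takes on
  \<open>R\<close>.\<close>

lemma higher_deriv_sum_simple_poles:
  fixes R :: "complex set"
  assumes "finite R" "\<And>z. z \<notin> R \<Longrightarrow> F z = (\<Sum>w\<in>R. 1 / (z - w))" "z \<notin> R"
  shows "(deriv ^^ n) F z = (-1) ^ n * fact n * (\<Sum>w\<in>R. 1 / (z - w) ^ Suc n)"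
  using assms(3)
proof (induction n arbitrary: z)
  case 0
  then show ?case using assms(2) by simp
next
  case (Suc n)
  let ?G = "\<lambda>z. (-1) ^ n * fact n * (\<Sum>w\<in>R. 1 / (z - w) ^ Suc n)"
  have "((\<lambda>x. 1 / (x - w) ^ Suc n) has_field_derivative - of_nat (Suc n) / (z - w) ^ Suc (Suc n)) (at z)"
    if "w \<in> R" for w
  proof -
    define u where "u = z - w"
    have u: "u \<noteq> 0" using Suc.prems that by (auto simp: u_def)
    have "((\<lambda>x. (x - w) ^ Suc n) has_field_derivative of_nat (Suc n) * u ^ n) (at z)"
      unfolding u_def by (auto intro!: derivative_eq_intros simp del: power_Suc)
    then have "((\<lambda>x. inverse ((x - w) ^ Suc n)) has_field_derivative
        - (inverse (u ^ Suc n) * (of_nat (Suc n) * u ^ n) * inverse (u ^ Suc n))) (at z)"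
      using u unfolding u_def by (intro DERIV_inverse') simp_all
    moreover have "- (inverse (u ^ Suc n) * (of_nat (Suc n) * u ^ n) * inverse (u ^ Suc n))
        = - of_nat (Suc n) / u ^ Suc (Suc n)"
      using u by (simp add: field_simps)
    ultimately show ?thesis by (simp only: u_def inverse_eq_divide)
  qed
  then have "(?G has_field_derivative
      (-1) ^ n * fact n * (\<Sum>w\<in>R. - of_nat (Suc n) / (z - w) ^ Suc (Suc n))) (at z)"
    by (intro DERIV_cmult DERIV_sum)
  then have "((deriv ^^ n) F has_field_derivative
      (-1) ^ n * fact n * (\<Sum>w\<in>R. - of_nat (Suc n) / (z - w) ^ Suc (Suc n))) (at z)"
    by (rule has_field_derivative_transform_within_open[where S = "- R"])
      (use Suc assms(1) in \<open>auto simp: finite_imp_closed\<close>)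
  moreover have "(\<Sum>w\<in>R. - of_nat (Suc n) / (z - w) ^ Suc (Suc n))
      = - of_nat (Suc n) * (\<Sum>w\<in>R. 1 / (z - w) ^ Suc (Suc n))"
    by (simp only: sum_distrib_left times_divide_eq_right mult_1_right)
  moreover have "(-1) ^ n * fact n * (- of_nat (Suc n) * S) = (-1) ^ Suc n * fact (Suc n) * S"
    for S :: complex by (simp add: algebra_simps)
  ultimately have "((deriv ^^ n) F has_field_derivative
      (-1) ^ Suc n * fact (Suc n) * (\<Sum>w\<in>R. 1 / (z - w) ^ Suc (Suc n))) (at z)"
    by (simp only:)
  then show ?case
    by (simp only: funpow.simps o_apply DERIV_imp_deriv)
qed

lemma logderiv_prod_linear:
  fixes R :: "complex set"
  assumes "finite R" "z \<notin> R"
  shows "deriv (poly (\<Prod>w\<in>R. [:- w, 1:])) z / poly (\<Prod>w\<in>R. [:- w, 1:]) z = (\<Sum>w\<in>R. 1 / (z - w))"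
proof -
  have "deriv (poly (\<Prod>w\<in>R. [:- w, 1:])) z = (\<Sum>w\<in>R. \<Prod>v\<in>R - {w}. z - v)"
    by (simp add: DERIV_imp_deriv[OF poly_DERIV] pderiv_prod pderiv_pCons poly_sum poly_prod)
  moreover have "(\<Prod>v\<in>R - {w}. z - v) / (\<Prod>v\<in>R. z - v) = 1 / (z - w)" if "w \<in> R" for w
  proof -
    have "(\<Prod>v\<in>R. z - v) = (z - w) * (\<Prod>v\<in>R - {w}. z - v)"
      using assms(1) that by (rule prod.remove)
    moreover have "(\<Prod>v\<in>R - {w}. z - v) \<noteq> 0" using assms by (auto simp: prod_zero_iff)
    ultimately show ?thesis by simp
  qed
  ultimately show ?thesis by (simp add: poly_prod sum_divide_distrib)
qed

lemma higher_logderiv_cyclotomic_neg1: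
  assumes "n > 0" "n \<noteq> 2"
  shows "higher_logderiv (Suc k) (poly (cyclotomic n)) (-1)
       = (-1) ^ k * fact k * s_sum (Suc k) (n_alpha n)"
proof -
  let ?R = "primitive_roots n"
  have fin: "finite ?R" using assms by (simp add: finite_primitive_roots)
  have m: "n_alpha n > 0" using n_alpha_gt_1[OF assms] by simp
  \<comment> \<open>The order of -1 is 2: the exponents 2 and 1 give \<open>n dvd 2\<close> and not
    \<open>n dvd 1\<close>, leaving only the excluded \<open>n = 2\<close>.\<close>
  have "-1 \<notin> ?R"
  proof
    assume "-1 \<in> ?R"
    then have R: "(-1 :: complex) ^ k = 1 \<longleftrightarrow> n dvd k" for k by (simp add: primitive_roots_def)
    have "n dvd 2" "\<not> n dvd 1" using R[of 2] R[of 1] by auto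
    then show False using assms(2) by (metis prime_nat_iff two_is_prime_nat One_nat_def dvd_refl)
  qed
  have cyc: "cyclotomic n = (\<Prod>w\<in>?R. [:- w, 1:])"
    unfolding cyclotomic_def by (rule prod_primitive_roots) fact
  have "higher_logderiv (Suc k) (poly (cyclotomic n)) (-1)
      = (-1) ^ k * fact k * (\<Sum>w\<in>?R. 1 / (-1 - w) ^ Suc k)"
    unfolding higher_logderiv_def diff_Suc_1
    using fin \<open>-1 \<notin> ?R\<close> by (intro higher_deriv_sum_simple_poles) (auto simp: cyc logderiv_prod_linear)
  also have "(\<Sum>w\<in>?R. 1 / (-1 - w) ^ Suc k) = (\<Sum>w\<in>?R. 1 / (- w - 1) ^ Suc k)"
  proof -
    have "- 1 - w = - w - 1" for w :: complex by simp
    then show ?thesis by (simp only:)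
  qed
  also have "\<dots> = (\<Sum>w\<in>primitive_roots (n_alpha n). 1 / (w - 1) ^ Suc k)"
    by (rule sum.reindex_bij_betw[OF bij_betw_uminus_primitive_roots])
  also have "\<dots> = s_sum (Suc k) (n_alpha n)"
    unfolding s_sum_def by (rule sum_primitive_roots[OF m, symmetric])
  finally show ?thesis .
qed

theorem theorem3p8:
  fixes k n :: nat
  assumes "k > 0" and "n > 0" and "n \<noteq> 2"
  shows "higher_logderiv k (poly (cyclotomic n)) (-1)
           = (-1) ^ (k - 1) * fact (k - 1) * s_sum k (n_alpha n)
       \<and> (-1) ^ (k - 1) * fact (k - 1) * s_sum k (n_alpha n)
           = (-1) ^ k * (\<Sum>j=1..k. of_real (bernoulli_plus j) * of_int (signed_stirling k j)
                                      / of_nat j * of_real (jordan_totient j (n_alpha n)))"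
proof -
  obtain l where k: "k = Suc l" using assms(1) gr0_implies_Suc by blast
  \<comment> \<open>The minus sign in \<open>s_sum_eq\<close> raises the exponent of -1 from
    \<open>l\<close> to \<open>k\<close>.\<close>
  have "(-1) ^ l * (fact l * s_sum (Suc l) (n_alpha n))
      = (-1) ^ Suc l * (\<Sum>j=1..Suc l. of_real (bernoulli_plus j) * of_int (signed_stirling (Suc l) j)
                                      / of_nat j * of_real (jordan_totient j (n_alpha n)))"
    by (simp only: s_sum_eq[OF n_alpha_gt_1[OF assms(2,3)]] power_Suc mult_minus_left mult_minus_right mult_1)
  then show ?thesis
    using higher_logderiv_cyclotomic_neg1[OF assms(2,3), of l]
    unfolding k diff_Suc_1 by (simp only: mult.assoc)
qed

end
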